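(* Let $(X,V,W,S,\mathcal H_*,h,*,\Theta)$ satisfy the abstract symmetrization framework described in the context, with $X$ a Hilbert space, and let $X$ be symmetrically embedded into $W$. Let $f:X\to\mathbb R$ be a lower semi-continuous functional bounded from below such that: (i) $f(u^H)\le f(u)$ for all $u\in S$ and $H\in\mathcal H_*$; (ii) to every $u\in X$ one can associate $\xi\in S$ such that $f(\xi)\le f(u)$, in such a way that (iii) if $(u_h)\subset X$ is bounded, then the sequence $(\xi_h)\subset S$ of the elements associated with $u_h$ is bounded; (iv) $\|u^H\|\le\|u\|$ for all $u\in S$ and $H\in\mathcal H_*$; (v) $f$ admits a bounded minimizing sequence. Then $f$ admits a $(SQPS)_{\inf f}$-sequence converging weakly in $X$ and strongly in $W$. If in addition $f$ satisfies the $(SQPS)_{\inf f}$ condition, there exists a point $z\in S$ such that $f(z)=\inf f$, $|df|(z)=0$, $z=z^*$ and $Q_z\ge0$ (i.e. $Q_z(w)\ge0$ for all $w\in X$).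
   Context: Abstract framework. $X,V,W$ are real Banach spaces with $X\subseteq V\subseteq W$, $X$ continuously embedded in $V$ and $V$ continuously embedded in $W$; $\|\cdot\|$ is the norm of $X$. $S\subseteq X$ carries the metric induced by $\|\cdot\|$, $\mathcal H_*$ is a path-connected topological space, and there are maps $*:S\to S$, $u\mapsto u^*$ (symmetrization) and $h:S\times\mathcal H_*\to S$, $(u,H)\mapsto u^H$ (polarization) such that: $h$ is continuous; $(u^* )^H=(u^H)^*=u^*$ and $(u^H)^H=u^H$ for all $u\in S$, $H\in\mathcal H_*$; there is a sequence $(H_m)\subset\mathcal H_*$ such that for every $u\in S$ the iterated polarizations $u^{H_1\cdots H_m}$ converge to $u^*$ in $V$ as $m\to\infty$; $\|u^H-v^H\|_V\le\|u-v\|_V$ for all $u,v\in S$, $H\in\mathcal H_*$. Moreover $\Theta:(X,\|\cdot\|_V)\to(S,\|\cdot\|_V)$ is Lipschitz with constant $C_\Theta>0$ and $\Theta|_S=\mathrm{Id}|_S$; for $u\in X$ one sets $u^H:=(\Theta(u))^H$ and $u^*:=(\Theta(u))^*$. Set $X_*:=\{u\in S: u^*=u\}$. $X$ is symmetrically embedded into $W$ if $\|u^*\|\le\|u\|$ for all $u\in X$ and the injection $X_*\hookrightarrow W$ is compact (sequences in $X_*$ bounded in $X$ have subsequences converging in $W$). Weak slope. For $u\in X$ with $f(u)\in\mathbb R$, $|df|(u)$ is the supremum of the $\sigma\in[0,\infty)$ such that there exist $\delta>0$ and a continuous map $\mathcal H:\big(B((u,f(u)),\delta)\cap\mathrm{epi}(f)\big)\times[0,\delta]\to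 X$ satisfying, for all $(\xi,\mu)\in B((u,f(u)),\delta)\cap\mathrm{epi}(f)$ and $t\in[0,\delta]$, $\|\mathcal H((\xi,\mu),t)-\xi\|\le t$ and $f(\mathcal H((\xi,\mu),t))\le f(\xi)-\sigma t$. Here $\mathrm{epi}(f)=\{(u,\lambda)\in X\times\mathbb R: f(u)\le\lambda\}$ and $B$ denotes open balls. For $u,w\in X$, $Q_u(w):=\limsup_{z\to u,\ \zeta\to w,\ t\to0}\dfrac{f(z+t\zeta)+f(z-t\zeta)-2f(z)}{t^2}\in[-\infty,+\infty]$. A sequence $(u_h)\subset X$ is a $(SQPS)_c$-sequence ($c\in\mathbb R$) if $f(u_h)\to c$, $|df|(u_h)\to0$, $\|u_h-u_h^*\|_V\to0$ and $\liminf_{h\to\infty}Q_{u_h}(w)\ge0$ for every $w\in X$. $f$ satisfies the $(SQPS)_c$ condition if every $(SQPS)_c$-sequence which admits a subsequence strongly converging in $W$, up to a subsequence, converges strongly in $X$. *)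

theory Defs
  imports "HOL-Analysis.Analysis"
begin

text \<open>
  The inclusions \<open>X \<subseteq> V \<subseteq> W\<close> are rendered by injective bounded linear maps
  \<open>\<iota>V : X \<rightarrow> V\<close> and \<open>\<iota>W : V \<rightarrow> W\<close>; thus the norm of \<open>V\<close> evaluated at a point \<open>u\<close> of \<open>X\<close>
  is \<open>norm (\<iota>V u)\<close>, and \<open>u\<close> seen in \<open>W\<close> is \<open>\<iota>W (\<iota>V u)\<close>.
\<close>

text \<open>
  The leftmost polarization is applied first, and \<open>Hs k\<close> stands for the polarizer with
  index \<open>k + 1\<close> of a sequence indexed from \<open>1\<close>.
\<close>

primrec iter_pol :: "('x \<Rightarrow> 'h \<Rightarrow> 'x) \<Rightarrow> (nat \<Rightarrow> 'h) \<Rightarrow> nat \<Rightarrow> 'x \<Rightarrow> 'x" where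
  "iter_pol pol Hs 0 u = u"
| "iter_pol pol Hs (Suc m) u = pol (iter_pol pol Hs m u) (Hs m)"

text \<open>
  \<open>star\<close> and \<open>pol\<close> are only constrained on \<open>S\<close>.  For an arbitrary \<open>u\<close> in \<open>X\<close>, the
  symmetrization \<open>u\<^sup>*\<close> is \<open>star (\<Theta> u)\<close>.
\<close>

locale symmetrization_framework =
  fixes \<iota>V :: "'x::banach \<Rightarrow> 'v::banach"
    and \<iota>W :: "'v \<Rightarrow> 'w::banach"
    and S :: "'x set"
    and Hstar :: "'h topology"
    and pol :: "'x \<Rightarrow> 'h \<Rightarrow> 'x"
    and star :: "'x \<Rightarrow> 'x"
    and \<Theta> :: "'x \<Rightarrow> 'x"
  assumes embed_V: "bounded_linear \<iota>V" "inj \<iota>V"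
    and embed_W: "bounded_linear \<iota>W" "inj \<iota>W"
    and path_connected_Hstar: "path_connected_space Hstar"
    and star_in_S: "u \<in> S \<Longrightarrow> star u \<in> S"
    and continuous_pol:
      "continuous_map (prod_topology (top_of_set S) Hstar) (top_of_set S) (\<lambda>(u, H). pol u H)"
    and pol_star: "u \<in> S \<Longrightarrow> H \<in> topspace Hstar \<Longrightarrow> pol (star u) H = star u"
    and star_pol: "u \<in> S \<Longrightarrow> H \<in> topspace Hstar \<Longrightarrow> star (pol u H) = star u"
    and pol_idem: "u \<in> S \<Longrightarrow> H \<in> topspace Hstar \<Longrightarrow> pol (pol u H) H = pol u H"
    and iter_pol_tendsto_star:
      "\<exists>Hs. range Hs \<subseteq> topspace Hstar \<and>
         (\<forall>u\<in>S. (\<lambda>m. \<iota>V (iter_pol pol Hs m u)) \<longlonglongrightarrow> \<iota>V (star u))"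
    and pol_nonexpansive:
      "u \<in> S \<Longrightarrow> v \<in> S \<Longrightarrow> H \<in> topspace Hstar \<Longrightarrow>
         norm (\<iota>V (pol u H - pol v H)) \<le> norm (\<iota>V (u - v))"
    and Theta_in_S: "\<Theta> u \<in> S"
    and Theta_Lipschitz: "\<exists>C>0. \<forall>u v. norm (\<iota>V (\<Theta> u - \<Theta> v)) \<le> C * norm (\<iota>V (u - v))"
    and Theta_id: "u \<in> S \<Longrightarrow> \<Theta> u = u"

definition symmetric_elements :: "'x set \<Rightarrow> ('x \<Rightarrow> 'x) \<Rightarrow> 'x set" where
  "symmetric_elements S star = {u \<in> S. star u = u}"

definition symmetrically_embedded ::
  "('x::banach \<Rightarrow> 'v::banach) \<Rightarrow> ('v \<Rightarrow> 'w::banach) \<Rightarrow> 'x set \<Rightarrow> ('x \<Rightarrow> 'x) \<Rightarrow> ('x \<Rightarrow> 'x) \<Rightarrow> bool"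
where
  "symmetrically_embedded \<iota>V \<iota>W S star \<Theta> \<longleftrightarrow>
     (\<forall>u. norm (star (\<Theta> u)) \<le> norm u) \<and>
     (\<forall>u :: nat \<Rightarrow> 'x. range u \<subseteq> symmetric_elements S star \<longrightarrow> bounded (range u) \<longrightarrow>
        (\<exists>r l. strict_mono r \<and> (\<lambda>n. \<iota>W (\<iota>V (u (r n)))) \<longlonglongrightarrow> l))"

definition lower_semicontinuous :: "('a::topological_space \<Rightarrow> real) \<Rightarrow> bool" where
  "lower_semicontinuous f \<longleftrightarrow> (\<forall>u a. a < f u \<longrightarrow> (\<forall>\<^sub>F z in nhds u. a < f z))"

definition weakly_converges :: "(nat \<Rightarrow> 'x::real_normed_vector) \<Rightarrow> 'x \<Rightarrow> bool" where
  "weakly_converges u x \<longleftrightarrow>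
     (\<forall>\<phi> :: 'x \<Rightarrow> real. bounded_linear \<phi> \<longrightarrow> (\<lambda>n. \<phi> (u n)) \<longlonglongrightarrow> \<phi> x)"

text \<open>
  The supremum may be infinite.  The metric of the product type \<open>'x \<times> real\<close> is the Euclidean
  combination of the two metrics.
\<close>

definition weak_slope :: "('x::real_normed_vector \<Rightarrow> real) \<Rightarrow> 'x \<Rightarrow> ereal" where
  "weak_slope f u = Sup {ereal \<sigma> |\<sigma>. 0 \<le> \<sigma> \<and>
     (\<exists>\<delta>>0. \<exists>\<H> :: ('x \<times> real) \<times> real \<Rightarrow> 'x.
        continuous_on ((ball (u, f u) \<delta> \<inter> epigraph UNIV f) \<times> {0..\<delta>}) \<H> \<and>
        (\<forall>(\<xi>, \<mu>) \<in> ball (u, f u) \<delta> \<inter> epigraph UNIV f. \<forall>t\<in>{0..\<delta>}.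
           norm (\<H> ((\<xi>, \<mu>), t) - \<xi>) \<le> t \<and> f (\<H> ((\<xi>, \<mu>), t)) \<le> f \<xi> - \<sigma> * t))}"

text \<open>
  In the upper limit, \<open>z\<close> and \<open>\<zeta>\<close> may take the values \<open>u\<close> and \<open>w\<close> themselves; only \<open>t = 0\<close> is
  excluded, since the quotient is undefined there.
\<close>

definition second_quotient :: "('x::real_normed_vector \<Rightarrow> real) \<Rightarrow> 'x \<Rightarrow> 'x \<Rightarrow> ereal" where
  "second_quotient f u w =
     Limsup (nhds u \<times>\<^sub>F nhds w \<times>\<^sub>F at (0::real))
       (\<lambda>(z, \<zeta>, t). ereal ((f (z + t *\<^sub>R \<zeta>) + f (z - t *\<^sub>R \<zeta>) - 2 * f z) / t\<^sup>2))"

definition SQPS_sequence ::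
  "('x::banach \<Rightarrow> 'v::banach) \<Rightarrow> ('x \<Rightarrow> 'x) \<Rightarrow> ('x \<Rightarrow> 'x) \<Rightarrow> ('x \<Rightarrow> real) \<Rightarrow> real \<Rightarrow> (nat \<Rightarrow> 'x) \<Rightarrow> bool"
where
  "SQPS_sequence \<iota>V star \<Theta> f c u \<longleftrightarrow>
     (\<lambda>n. f (u n)) \<longlonglongrightarrow> c \<and>
     (\<lambda>n. weak_slope f (u n)) \<longlonglongrightarrow> 0 \<and>
     (\<lambda>n. norm (\<iota>V (u n - star (\<Theta> (u n))))) \<longlonglongrightarrow> 0 \<and>
     (\<forall>w. 0 \<le> liminf (\<lambda>n. second_quotient f (u n) w))"

definition SQPS_condition ::
  "('x::banach \<Rightarrow> 'v::banach) \<Rightarrow> ('v \<Rightarrow> 'w::banach) \<Rightarrow> ('x \<Rightarrow> 'x) \<Rightarrow> ('x \<Rightarrow> 'x) \<Rightarrow>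
     ('x \<Rightarrow> real) \<Rightarrow> real \<Rightarrow> bool"
where
  "SQPS_condition \<iota>V \<iota>W star \<Theta> f c \<longleftrightarrow>
     (\<forall>u. SQPS_sequence \<iota>V star \<Theta> f c u \<longrightarrow>
        (\<exists>r l. strict_mono r \<and> (\<lambda>n. \<iota>W (\<iota>V (u (r n)))) \<longlonglongrightarrow> l) \<longrightarrow>
        (\<exists>r x. strict_mono r \<and> (\<lambda>n. u (r n)) \<longlonglongrightarrow> x))"

end

theory Submission
  imports Defs
begin

text \<open>
  A bounded minimizing sequence is moved into \<open>S\<close> by \<open>\<Xi>\<close> and then polarized so often that it is
  \<open>V\<close>-close to its symmetrization; neither step increases \<open>f\<close> or destroys boundedness.  A small
  Borwein--Preiss perturbation yields nearby points at which \<open>f\<close> is supported from below by a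
  quadratic polynomial with small coefficients, which bounds the weak slope from above and the second
  quotient from below.  Since symmetrization is Lipschitz for the norm of \<open>V\<close>, the new points are
  still almost symmetric, and compactness of the symmetric elements in \<open>W\<close> gives the limit.
\<close>

section \<open>Lower semicontinuity and quadratic perturbation of almost minimizers\<close>

text \<open>If \<open>v\<close> is already within \<open>e\<close> of the infimum, it is kept;
  otherwise any point that is within \<open>e\<close> of the infimum lies below \<open>v\<close>.
  This is the selection step of the Borwein--Preiss recursion.\<close>

lemma nonincreasing_almost_minimizer:
  fixes g :: "'a \<Rightarrow> real"
  assumes "bdd_below (range g)" "e > 0"
  shows "\<exists>v'. g v' \<le> g v \<and> (\<forall>w. g v' \<le> g w + e)"
proof (cases "g v \<le> (INF x. g x) + e")
  case True
  have "g v \<le> g w + e" for w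
    using cINF_lower[OF assms(1), of w] True by simp
  then show ?thesis by blast
next
  case False
  have "(INF x. g x) < (INF x. g x) + e" using assms by simp
  then obtain v' where v': "g v' < (INF x. g x) + e"
    using cINF_less_iff[OF _ assms(1), of "(INF x. g x) + e"] by auto
  have "g v' \<le> g w + e" for w
    using cINF_lower[OF assms(1), of w] v' by simp
  then show ?thesis using v' False by (intro exI[of _ v']) auto
qed

text \<open>The bound may vary along the sequence: in the Borwein--Preiss argument it contains
  penalties that converge together with \<open>x\<close>.\<close>

lemma lower_semicontinuous_limit_le:
  assumes "lower_semicontinuous f" "x \<longlonglongrightarrow> v" "\<forall>\<^sub>F n in sequentially. f (x n) \<le> b n" "b \<longlonglongrightarrow> c"
  shows "f v \<le> c"
proof (rule ccontr)
  assume "\<not> f v \<le> c"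
  then obtain a where a: "c < a" "a < f v" using dense by (meson not_le)
  have "\<forall>\<^sub>F z in nhds v. a < f z" using assms(1) a unfolding lower_semicontinuous_def by blast
  then have "\<forall>\<^sub>F n in sequentially. a < f (x n)"
    using assms(2) unfolding filterlim_iff by blast
  moreover have "\<forall>\<^sub>F n in sequentially. b n < a" using assms(4) a(1) by (rule order_tendstoD)
  ultimately have "\<forall>\<^sub>F n in sequentially. False" using assms(3)
    by eventually_elim linarith
  then show False by simp
qed

text \<open>
  In the Hilbert setting the Borwein--Preiss perturbation, a series of squared distances, is a
  single quadratic polynomial around \<open>v\<close>.
\<close>

lemma Borwein_Preiss_Hilbert:
  fixes f :: "'x::{real_inner, banach} \<Rightarrow> real"
  assumes lsc: "lower_semicontinuous f" and bdd: "bdd_below (range f)"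
    and \<eta>: "\<eta> > 0" and \<rho>: "\<rho> > 0"
    and u: "\<And>w. f u \<le> f w + \<eta> * \<rho>\<^sup>2"
  shows "\<exists>v p. norm (v - u) \<le> 2 * \<rho> \<and> norm p \<le> 16 * \<eta> * \<rho> \<and> f v \<le> f u \<and>
           (\<forall>w. f v \<le> f w + 2 * \<eta> * (norm (w - v))\<^sup>2 + p \<bullet> (w - v))"
proof -
  \<comment> \<open>The weights \<open>h n\<close> of the penalties sum to
    \<open>2 * \<eta>\<close>, the final quadratic coefficient. The tolerance \<open>e n\<close>
    makes \<open>e n / h n\<close> the square of the intended step length
    \<open>\<rho> * (1/2) ^ n\<close>, and \<open>e 0\<close> is the accuracy assumed of
    \<open>u\<close>.\<close>
  define h where "h n = \<eta> * (1/2) ^ n" for n :: nat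
  define e where "e n = h n * (\<rho> * (1/2) ^ n)\<^sup>2" for n :: nat
  have e_pos: "e n > 0" and h_pos: "h n > 0" for n
    using \<eta> \<rho> by (auto simp: e_def h_def)
  \<comment> \<open>A state pairs the current penalized functional with an almost minimizer of it.
    \<open>P\<close> is the invariant, and its clause for \<open>n = 0\<close> pins the start;
    \<open>Q\<close> adds a penalty centred at the current point.\<close>
  define P where "P n gv \<longleftrightarrow> bdd_below (range (fst gv)) \<and> (\<forall>w. fst gv (snd gv) \<le> fst gv w + e n) \<and>
      (n = 0 \<longrightarrow> gv = (f, u))" for n and gv :: "('x \<Rightarrow> real) \<times> 'x"
  define Q where "Q n gv gv' \<longleftrightarrow> fst gv' = (\<lambda>w. fst gv w + h n * (norm (w - snd gv))\<^sup>2) \<and>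
      fst gv' (snd gv') \<le> fst gv' (snd gv)" for n and gv gv' :: "('x \<Rightarrow> real) \<times> 'x"
  have "\<exists>gv'. P (Suc n) gv' \<and> Q n gv gv'" if "P n gv" for gv n
  proof -
    let ?g = "\<lambda>w. fst gv w + h n * (norm (w - snd gv))\<^sup>2"
    obtain m where "\<And>w. m \<le> fst gv w"
      using \<open>P n gv\<close> unfolding P_def bdd_below_def by auto
    then have "m \<le> ?g w" for w
      using h_pos[of n] by (smt (verit, ccfv_threshold) mult_nonneg_nonneg zero_le_power2)
    then have b: "bdd_below (range ?g)" by (auto simp: bdd_below_def)
    obtain v' where "?g v' \<le> ?g (snd gv)" "\<forall>w. ?g v' \<le> ?g w + e (Suc n)"
      using nonincreasing_almost_minimizer[OF b e_pos] by blast
    then show ?thesis using b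
      by (intro exI[of _ "(?g, v')"]) (auto simp: P_def Q_def)
  qed
  moreover have "P 0 (f, u)" using bdd u by (auto simp: P_def e_def h_def)
  ultimately obtain gv where gv: "\<And>n. P n (gv n)" "\<And>n. Q n (gv n) (gv (Suc n))"
    using dependent_nat_choice[of P Q] by blast
  define g where "g n = fst (gv n)" for n
  define x where "x n = snd (gv n)" for n
  have g0: "g 0 = f" "x 0 = u" using gv(1)[of 0] by (auto simp: P_def g_def x_def)
  have gmin: "g n (x n) \<le> g n w + e n" for n w
    using gv(1)[of n] by (auto simp: P_def g_def x_def)
  have gSuc: "g (Suc n) w = g n w + h n * (norm (w - x n))\<^sup>2" for n w
    using gv(2)[of n] by (auto simp: Q_def g_def x_def)
  \<comment> \<open>The new penalty vanishes at its own centre \<open>x n\<close>, so there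
    \<open>g (Suc n)\<close> agrees with \<open>g n\<close>.\<close>
  have gdec: "g (Suc n) (x (Suc n)) \<le> g n (x n)" for n
    using gv(2)[of n] by (auto simp: Q_def g_def x_def)
  have g_sum: "g n w = f w + (\<Sum>k<n. h k * (norm (w - x k))\<^sup>2)" for n w
    by (induction n) (auto simp: g0 gSuc)
  have g_inc: "g n w \<le> g m w" if "n \<le> m" for n m w
    by (rule lift_Suc_mono_le[OF _ that]) (use h_pos in \<open>simp add: gSuc less_imp_le\<close>)
  have g_dec: "g m (x m) \<le> g n (x n)" if "n \<le> m" for n m
    by (rule lift_Suc_antimono_le[of "\<lambda>n. g n (x n)", OF _ that]) (rule gdec)

  have step: "norm (x (Suc n) - x n) \<le> \<rho> * (1/2) ^ n" for n
  proof -
    have "h n * (norm (x (Suc n) - x n))\<^sup>2 \<le> e n"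
      using gdec[of n] gmin[of n "x (Suc n)"] gSuc[of n "x (Suc n)"] by linarith
    then have "(norm (x (Suc n) - x n))\<^sup>2 \<le> e n / h n"
      using h_pos[of n] by (simp add: field_simps)
    also have "e n / h n = (\<rho> * (1/2) ^ n)\<^sup>2"
      using h_pos[of n] by (simp add: e_def)
    finally show ?thesis by (rule power2_le_imp_le) (use \<rho> in simp)
  qed
  have geo: "(\<lambda>n. \<rho> * (1/2) ^ n) sums (\<rho> * 2)"
    using geometric_sums[of "1/2::real"] by (intro sums_mult) simp
  have dsum: "summable (\<lambda>n. x (Suc n) - x n)"
    by (rule summable_comparison_test'[OF sums_summable[OF geo]]) (rule step)
  define v where "v = u + (\<Sum>n. x (Suc n) - x n)"
  have tele: "(\<Sum>k<n. x (Suc k) - x k) = x n - u" for n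
    using sum_lessThan_telescope[of x n] g0 by simp
  have lim: "x \<longlonglongrightarrow> v"
    using tendsto_add[OF tendsto_const[of u] summable_LIMSEQ[OF dsum]] by (simp add: tele v_def)
  have near: "norm (x n - u) \<le> 2 * \<rho>" for n
  proof -
    have "norm (x n - u) \<le> (\<Sum>k<n. norm (x (Suc k) - x k))"
      unfolding tele[symmetric] by (rule norm_sum)
    also have "\<dots> \<le> (\<Sum>k<n. \<rho> * (1/2) ^ k)" by (intro sum_mono step)
    also have "\<dots> \<le> \<rho> * 2"
      using sum_le_suminf[OF sums_summable[OF geo], of "{..<n}"] sums_unique[OF geo] \<rho> by simp
    finally show ?thesis by simp
  qed
  have vu: "norm (v - u) \<le> 2 * \<rho>"
    by (rule LIMSEQ_le_const2[OF tendsto_norm[OF tendsto_diff[OF lim tendsto_const]]]) (use near in auto)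
  have vx: "norm (v - x n) \<le> 4 * \<rho>" for n
    using norm_triangle_ineq4[of "v - u" "x n - u"] vu near[of n] by simp

  \<comment> \<open>For \<open>m \<ge> n\<close>,
    \<open>g n (x m) \<le> g m (x m) \<le> g n (x n)\<close>. In the limit over \<open>m\<close> the
    finitely many penalties are continuous, and only \<open>f\<close> needs lower
    semicontinuity.\<close>
  have v_min: "f v + (\<Sum>k<n. h k * (norm (v - x k))\<^sup>2) \<le> g n (x n)" for n
  proof -
    have "f v \<le> g n (x n) - (\<Sum>k<n. h k * (norm (v - x k))\<^sup>2)"
    proof (rule lower_semicontinuous_limit_le[OF lsc lim])
      show "\<forall>\<^sub>F m in sequentially. f (x m) \<le> g n (x n) - (\<Sum>k<n. h k * (norm (x m - x k))\<^sup>2)"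
        using eventually_ge_at_top[of n]
      proof eventually_elim
        case (elim m)
        show ?case using g_inc[OF elim, of "x m"] g_dec[OF elim] g_sum[of n "x m"] by linarith
      qed
    qed (intro tendsto_intros lim)
    then show ?thesis by simp
  qed

  have hsums: "h sums (2 * \<eta>)"
    using sums_mult[OF geometric_sums[of "1/2::real"], of \<eta>] by (simp add: h_def[abs_def] mult.commute)
  \<comment> \<open>\<open>q k\<close> is the linear coefficient of the penalty with index
    \<open>k\<close> expanded around \<open>v\<close>; its bound uses
    \<open>norm (v - x k) \<le> 4 * \<rho>\<close>.\<close>
  define q where "q k = (2 * h k) *\<^sub>R (v - x k)" for k
  have q_le: "norm (q k) \<le> 8 * \<rho> * h k" for k
    using mult_left_mono[OF vx[of k], of "2 * h k"] h_pos[of k] by (simp add: q_def mult_ac)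
  have q_bound: "(\<lambda>k. 8 * \<rho> * h k) sums (8 * \<rho> * (2 * \<eta>))" by (intro sums_mult hsums)
  have qsum: "summable q"
    by (rule summable_comparison_test'[OF sums_summable[OF q_bound]]) (rule q_le)

  have "f v \<le> f w + 2 * \<eta> * (norm (w - v))\<^sup>2 + suminf q \<bullet> (w - v)" for w
  proof -
    have expand: "(norm (w - x k))\<^sup>2 = (norm (v - x k))\<^sup>2 + (norm (w - v))\<^sup>2 + 2 * ((v - x k) \<bullet> (w - v))" for k
    proof -
      have "(norm ((v - x k) + (w - v)))\<^sup>2 = (norm (v - x k))\<^sup>2 + (norm (w - v))\<^sup>2 + 2 * ((v - x k) \<bullet> (w - v))"
        by (simp only: power2_norm_eq_inner inner_add_left inner_add_right inner_commute[of "w - v" "v - x k"])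
      then show ?thesis by simp
    qed
    \<comment> \<open>\<open>v_min\<close> is combined with the almost minimality of
      \<open>x n\<close> for \<open>g n\<close>. After expansion around \<open>v\<close> the
      constant parts of the penalties cancel, leaving a linear and a quadratic term.\<close>
    have fin: "f v \<le> f w + (\<Sum>k<n. h k) * (norm (w - v))\<^sup>2 + (\<Sum>k<n. q k) \<bullet> (w - v) + e n" for n
    proof -
      have "f v + (\<Sum>k<n. h k * (norm (v - x k))\<^sup>2) \<le> f w + (\<Sum>k<n. h k * (norm (w - x k))\<^sup>2) + e n"
        using v_min[of n] gmin[of n w] g_sum[of n w] by linarith
      also have "(\<Sum>k<n. h k * (norm (w - x k))\<^sup>2) =
          (\<Sum>k<n. h k * (norm (v - x k))\<^sup>2) + (\<Sum>k<n. h k) * (norm (w - v))\<^sup>2 + (\<Sum>k<n. q k) \<bullet> (w - v)"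
        by (simp add: expand q_def inner_sum_left sum_distrib_right distrib_left sum.distrib mult_ac)
      finally show ?thesis by simp
    qed
    have "(\<lambda>n. \<eta> * (1/2) ^ n * (\<rho> * (1/2) ^ n)\<^sup>2) \<longlonglongrightarrow> \<eta> * 0 * (\<rho> * 0)\<^sup>2"
      by (intro tendsto_intros LIMSEQ_power_zero) auto
    then have "e \<longlonglongrightarrow> 0" by (simp add: e_def[abs_def] h_def)
    then have "(\<lambda>n. f w + (\<Sum>k<n. h k) * (norm (w - v))\<^sup>2 + (\<Sum>k<n. q k) \<bullet> (w - v) + e n)
        \<longlonglongrightarrow> f w + 2 * \<eta> * (norm (w - v))\<^sup>2 + suminf q \<bullet> (w - v) + 0"
      by (intro tendsto_intros summable_LIMSEQ[OF qsum] hsums[unfolded sums_def])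
    then show ?thesis using LIMSEQ_le_const[of _ _ "f v"] fin by fastforce
  qed
  moreover have "norm (suminf q) \<le> 16 * \<eta> * \<rho>"
    using norm_suminf_le[of q, OF q_le sums_summable[OF q_bound]] sums_unique[OF q_bound] by (simp add: mult_ac)
  moreover have "f v \<le> f u" using v_min[of 0] g0 by simp
  ultimately show ?thesis using vu by blast
qed

section \<open>Weak slope and second quotient at a point with quadratic support\<close>

text \<open>The deformation that leaves every point in place is admissible for
  \<open>\<sigma> = 0\<close>.\<close>

lemma weak_slope_nonneg: "0 \<le> weak_slope f u"
  unfolding weak_slope_def
proof (rule Sup_upper, clarsimp, intro exI conjI)
  show "continuous_on ((ball (u, f u) 1 \<inter> epigraph UNIV f) \<times> {0..1::real}) (\<lambda>x. fst (fst x))"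
    by (intro continuous_intros)
qed auto

text \<open>A deformation of rate \<open>\<sigma>\<close> moves \<open>v\<close> by at most
  \<open>t\<close> and lowers \<open>f\<close> by at least \<open>\<sigma> * t\<close>, whereas the
  support allows a drop of at most \<open>s * t\<^sup>2 + norm p * t\<close>. Divide by
  \<open>t\<close> and let it tend to \<open>0\<close>.\<close>

lemma weak_slope_le_quadratic:
  fixes f :: "'x::real_inner \<Rightarrow> real"
  assumes v: "\<And>w. f v \<le> f w + s * (norm (w - v))\<^sup>2 + p \<bullet> (w - v)" and s: "s \<ge> 0"
  shows "weak_slope f v \<le> ereal (norm p)"
  unfolding weak_slope_def
proof (rule Sup_least, clarsimp)
  fix \<sigma> \<delta> :: real and H :: "('x \<times> real) \<times> real \<Rightarrow> 'x"
  assume \<delta>: "\<delta> > 0"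
    and H: "\<forall>(\<xi>, \<mu>) \<in> ball (v, f v) \<delta> \<inter> epigraph UNIV f. \<forall>t\<in>{0..\<delta>}.
           norm (H ((\<xi>, \<mu>), t) - \<xi>) \<le> t \<and> f (H ((\<xi>, \<mu>), t)) \<le> f \<xi> - \<sigma> * t"
  have "(v, f v) \<in> ball (v, f v) \<delta> \<inter> epigraph UNIV f" using \<delta> by (simp add: mem_epigraph)
  then have H': "norm (H ((v, f v), t) - v) \<le> t" "f (H ((v, f v), t)) \<le> f v - \<sigma> * t"
    if "t \<in> {0..\<delta>}" for t using H that by blast+
  have *: "\<sigma> \<le> norm p + s * t" if t: "0 < t" "t \<le> \<delta>" for t
  proof -
    let ?d = "H ((v, f v), t) - v"
    have d: "norm ?d \<le> t" using H'[of t] t by simp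
    have "\<sigma> * t \<le> s * (norm ?d)\<^sup>2 + p \<bullet> ?d" using v[of "H ((v, f v), t)"] H'(2)[of t] t by simp
    also have "\<dots> \<le> s * t\<^sup>2 + norm p * t"
      using d s by (intro add_mono mult_left_mono power_mono order_trans[OF norm_cauchy_schwarz]) auto
    also have "\<dots> = (norm p + s * t) * t" by (simp add: power2_eq_square algebra_simps)
    finally show ?thesis using t by simp
  qed
  have "((\<lambda>t. norm p + s * t) \<longlongrightarrow> norm p + s * 0) (at_right 0)" by (intro tendsto_intros)
  moreover have "\<forall>\<^sub>F t in at_right 0. \<sigma> \<le> norm p + s * t"
    using eventually_at_right_less[of 0] eventually_at_right_real[OF \<delta>]
    by eventually_elim (use * in auto)
  ultimately show "\<sigma> \<le> norm p" using tendsto_lowerbound[of _ _ "at_right (0::real)"] by fastforce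
qed

text \<open>The linear term cancels when the support inequalities at
  \<open>v + t *\<^sub>R w\<close> and \<open>v - t *\<^sub>R w\<close> are added.\<close>

lemma second_quotient_ge_quadratic:
  fixes f :: "'x::real_inner \<Rightarrow> real"
  assumes v: "\<And>w. f v \<le> f w + s * (norm (w - v))\<^sup>2 + p \<bullet> (w - v)"
  shows "ereal (- 2 * s * (norm w)\<^sup>2) \<le> second_quotient f v w"
  unfolding second_quotient_def Limsup_def
proof (rule INF_greatest, clarsimp)
  fix P :: "'x \<times> 'x \<times> real \<Rightarrow> bool"
  assume "eventually P (nhds v \<times>\<^sub>F nhds w \<times>\<^sub>F at 0)"
  \<comment> \<open>The upper limit admits the base point and the direction themselves, so it is
    bounded below by values on the curve with \<open>z = v\<close> and \<open>\<zeta> = w\<close>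
    fixed.\<close>
  moreover have "filterlim (\<lambda>t. (v, w, t)) (nhds v \<times>\<^sub>F nhds w \<times>\<^sub>F at 0) (at (0::real))"
    by (intro filterlim_Pair tendsto_const filterlim_ident)
  ultimately have "\<forall>\<^sub>F t in at 0. P (v, w, t)" unfolding filterlim_iff by blast
  then have "\<forall>\<^sub>F t in at 0. P (v, w, t) \<and> t \<noteq> 0"
    by (rule eventually_conj) (simp add: eventually_at_filter)
  then obtain t where t: "P (v, w, t)" "t \<noteq> 0"
    using eventually_happens[of _ "at (0::real)"] by auto
  have "- 2 * s * (norm w)\<^sup>2 * t\<^sup>2 \<le> f (v + t *\<^sub>R w) + f (v - t *\<^sub>R w) - 2 * f v"
    using v[of "v + t *\<^sub>R w"] v[of "v - t *\<^sub>R w"] by (simp add: power_mult_distrib algebra_simps)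
  then have "- 2 * s * (norm w)\<^sup>2 \<le> (f (v + t *\<^sub>R w) + f (v - t *\<^sub>R w) - 2 * f v) / t\<^sup>2"
    using t by (simp add: pos_le_divide_eq)
  then show "ereal (- (2 * s * (norm w)\<^sup>2)) \<le> (SUP x\<in>Collect P. case x of (z, \<zeta>, t) \<Rightarrow>
      ereal ((f (z + t *\<^sub>R \<zeta>) + f (z - t *\<^sub>R \<zeta>) - 2 * f z) / t\<^sup>2))"
    by (intro SUP_upper2[of "(v, w, t)"]) (use t in auto)
qed

section \<open>Limits of images of bounded sequences and weak convergence\<close>

text \<open>
  By the parallelogram law, the sets of almost norm-minimal elements of the convex sets
  \<open>{y. dist (T y) l \<le> \<epsilon>}\<close> have diameters tending to \<open>0\<close> with \<open>\<epsilon>\<close>.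
\<close>

lemma bounded_sequence_image_limit:
  fixes T :: "'x::{real_inner, banach} \<Rightarrow> 'z::real_normed_vector"
  assumes T: "bounded_linear T" and v: "bounded (range v)" and lim: "(\<lambda>n. T (v n)) \<longlonglongrightarrow> l"
  shows "\<exists>y. T y = l"
proof -
  interpret T: bounded_linear T by (rule T)
  define C where "C n = {y. dist (T y) l \<le> inverse (real (Suc n))}" for n
  define D where "D n = (INF y\<in>C n. (norm y)\<^sup>2)" for n
  obtain M where M: "\<And>n. norm (v n) \<le> M" using v unfolding bounded_iff by blast
  have bdd: "bdd_below ((\<lambda>y. (norm y)\<^sup>2) ` A)" for A :: "'x set" by (rule bdd_belowI2[of _ 0]) simp
  have vC: "\<exists>k. v k \<in> C n" for n
  proof -
    have "\<forall>\<^sub>F k in sequentially. dist (T (v k)) l < inverse (real (Suc n))"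
      using lim by (rule tendstoD) simp
    then show ?thesis unfolding C_def eventually_sequentially by (auto intro: less_imp_le)
  qed
  then have ne: "C n \<noteq> {}" for n by blast
  have C_dec: "C m \<subseteq> C n" if "n \<le> m" for n m
    using that unfolding C_def by (auto elim!: order_trans intro!: le_imp_inverse_le)
  have D_le: "D n \<le> (norm y)\<^sup>2" if "y \<in> C n" for n y
    unfolding D_def using bdd that by (rule cINF_lower)
  have D_inc: "incseq D"
    unfolding D_def incseq_def by (auto intro!: cINF_superset_mono ne bdd C_dec)
  \<comment> \<open>The bounded sequence \<open>v\<close> meets every \<open>C n\<close>, which
    keeps the increasing infima bounded.\<close>
  have D_M: "D n \<le> M\<^sup>2" for n
  proof -
    obtain k where "v k \<in> C n" using vC by blast
    then have "D n \<le> (norm (v k))\<^sup>2" by (rule D_le)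
    also have "\<dots> \<le> M\<^sup>2" using M by (intro power_mono) auto
    finally show ?thesis .
  qed
  obtain d where d: "D \<longlonglongrightarrow> d" and D_d: "\<And>n. D n \<le> d"
    using incseq_convergent[OF D_inc, of "M\<^sup>2"] D_M by auto
  \<comment> \<open>Almost minimality is measured against the limit \<open>d\<close> and not against
    \<open>D n\<close>; this makes the sets \<open>K n\<close> nested.\<close>
  define K where "K n = {y \<in> C n. (norm y)\<^sup>2 \<le> d + inverse (real (Suc n))}" for n
  have K_ne: "K n \<noteq> {}" for n
  proof -
    have "D n < d + inverse (real (Suc n))" using D_d[of n] by (rule le_less_trans) simp
    then obtain y where "y \<in> C n" "(norm y)\<^sup>2 < d + inverse (real (Suc n))"
      using cINF_less_iff[OF ne bdd] unfolding D_def by blast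
    then show ?thesis unfolding K_def by force
  qed
  have mid: "(1/2) *\<^sub>R (y + y') \<in> C n" if "y \<in> C n" "y' \<in> C n" for y y' n
  proof -
    have "T ((1/2) *\<^sub>R (y + y')) - l = (1/2) *\<^sub>R ((T y - l) + (T y' - l))"
      by (simp add: T.scaleR T.add algebra_simps flip: scaleR_2)
    then have "norm (T ((1/2) *\<^sub>R (y + y')) - l) \<le> 1/2 * (norm (T y - l) + norm (T y' - l))"
      using norm_triangle_ineq[of "T y - l" "T y' - l"] by simp
    then show ?thesis using that unfolding C_def dist_norm by auto
  qed
  \<comment> \<open>The midpoint of \<open>y\<close> and \<open>y'\<close> stays in
    \<open>C n\<close>, so its squared norm is at least \<open>D n\<close>; the parallelogram law
    turns this into a diameter bound.\<close>
  have close: "(dist y y')\<^sup>2 \<le> 4 * (d + inverse (real (Suc n)) - D n)" if "y \<in> K n" "y' \<in> K n" for y y' n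
  proof -
    have "D n \<le> (norm ((1/2) *\<^sub>R (y + y')))\<^sup>2" using that mid by (intro D_le) (auto simp: K_def)
    then have "4 * D n \<le> (norm (y + y'))\<^sup>2" by (simp add: power_divide)
    moreover have "(dist y y')\<^sup>2 = 2 * (norm y)\<^sup>2 + 2 * (norm y')\<^sup>2 - (norm (y + y'))\<^sup>2"
      unfolding dist_norm power2_norm_eq_inner by (simp add: inner_simps inner_commute)
    ultimately show ?thesis using that unfolding K_def by auto
  qed
  obtain y where "\<And>n. y \<in> K n"
  proof (rule decreasing_closed_nest[of K])
    show "closed (K n)" for n
      unfolding K_def C_def
      by (auto intro!: closed_Collect_conj closed_Collect_le continuous_intros T.continuous_on)
    show "K n \<noteq> {}" for n by (rule K_ne)
    show "K n \<subseteq> K m" if "m \<le> n" for m n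
    proof -
      have "inverse (real (Suc n)) \<le> inverse (real (Suc m))" using that by (intro le_imp_inverse_le) auto
      then show ?thesis using C_dec[OF that] unfolding K_def
        by (auto elim: order_trans)
    qed
    fix e :: real assume e: "e > 0"
    have "(\<lambda>n. 4 * (d + inverse (real (Suc n)) - D n)) \<longlonglongrightarrow> 4 * (d + 0 - d)"
      by (intro tendsto_intros d LIMSEQ_inverse_real_of_nat)
    then have "\<forall>\<^sub>F n in sequentially. 4 * (d + inverse (real (Suc n)) - D n) < e\<^sup>2"
      by (rule order_tendstoD) (use e in simp)
    then obtain n where n: "4 * (d + inverse (real (Suc n)) - D n) < e\<^sup>2"
      unfolding eventually_sequentially by blast
    have "dist y y' < e" if "y \<in> K n" "y' \<in> K n" for y y'
      using close[OF that] n e by (auto intro: power2_less_imp_less[of "dist y y'"])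
    then show "\<exists>n. \<forall>x\<in>K n. \<forall>y\<in>K n. dist x y < e" by blast
  qed blast
  then have "dist (T y) l \<le> inverse (real (Suc n))" for n unfolding K_def C_def by blast
  then have "dist (T y) l \<le> 0"
    using LIMSEQ_le_const[OF LIMSEQ_inverse_real_of_nat] by blast
  then show ?thesis by auto
qed

text \<open>
  Applying the previous lemma to \<open>(\<phi>, T)\<close> for each functional \<open>\<phi>\<close> identifies the cluster points of
  \<open>\<phi> (v n)\<close>, which makes weak compactness of balls and the Hahn--Banach theorem unnecessary.
\<close>

lemma weakly_converges_of_injective_image:
  fixes T :: "'x::{real_inner, banach} \<Rightarrow> 'z::real_normed_vector"
  assumes T: "bounded_linear T" "inj T" and v: "bounded (range v)" and lim: "(\<lambda>n. T (v n)) \<longlonglongrightarrow> l"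
  shows "\<exists>y. weakly_converges v y \<and> T y = l"
proof -
  obtain y where y: "T y = l" using bounded_sequence_image_limit[OF T(1) v lim] by blast
  have "(\<lambda>n. \<phi> (v n)) \<longlonglongrightarrow> \<phi> y" if \<phi>: "bounded_linear \<phi>" for \<phi> :: "'x \<Rightarrow> real"
  proof (rule ccontr)
    assume "\<not> (\<lambda>n. \<phi> (v n)) \<longlonglongrightarrow> \<phi> y"
    then obtain e where e: "e > 0" "\<not> (\<forall>\<^sub>F n in sequentially. dist (\<phi> (v n)) (\<phi> y) < e)"
      unfolding tendsto_iff by blast
    then have "\<exists>\<^sub>\<infinity>n. \<not> dist (\<phi> (v n)) (\<phi> y) < e"
      by (simp add: frequently_def cofinite_eq_sequentially)
    then obtain r :: "nat \<Rightarrow> nat" where r: "strict_mono r" "\<And>n. \<not> dist (\<phi> (v (r n))) (\<phi> y) < e"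
      using infinite_enumerate[of "{n. \<not> dist (\<phi> (v n)) (\<phi> y) < e}"] by (auto simp: INFM_iff_infinite)
    have "bounded (range (\<lambda>n. \<phi> (v (r n))))"
      by (rule bounded_subset[OF bounded_linear_image[OF v \<phi>]]) auto
    then obtain a s where s: "strict_mono (s :: nat \<Rightarrow> nat)" "(\<lambda>n. \<phi> (v (r (s n)))) \<longlonglongrightarrow> a"
      using bounded_imp_convergent_subsequence by (force simp: comp_def)
    have rs: "strict_mono (r \<circ> s)" using r s by (simp add: strict_mono_o)
    \<comment> \<open>A preimage of \<open>(a, l)\<close> is sent to \<open>l\<close> by
      \<open>T\<close>, so by injectivity it is \<open>y\<close>; hence the cluster point
      \<open>a\<close> equals \<open>\<phi> y\<close>, against the choice of
      \<open>r\<close>.\<close>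
    have "\<exists>y'. (\<phi> y', T y') = (a, l)"
    proof (rule bounded_sequence_image_limit)
      show "bounded_linear (\<lambda>y. (\<phi> y, T y))" using \<phi> T(1) by (rule bounded_linear_Pair)
      show "bounded (range (v \<circ> (r \<circ> s)))" by (rule bounded_subset[OF v]) auto
      show "(\<lambda>n. (\<phi> ((v \<circ> (r \<circ> s)) n), T ((v \<circ> (r \<circ> s)) n))) \<longlonglongrightarrow> (a, l)"
        using tendsto_Pair[OF s(2) LIMSEQ_subseq_LIMSEQ[OF lim rs, unfolded comp_def]] by (simp add: comp_def)
    qed
    then have "a = \<phi> y" using y T(2) by (auto dest: injD)
    then have "\<forall>\<^sub>F n in sequentially. dist (\<phi> (v (r (s n)))) (\<phi> y) < e"
      using tendstoD[OF s(2) e(1)] by simp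
    then show False using r(2) by simp
  qed
  then show ?thesis using y unfolding weakly_converges_def by blast
qed

section \<open>Symmetrization as the limit of iterated polarizations\<close>

context symmetrization_framework
begin

text \<open>That polarization maps \<open>S\<close> into itself is encoded in the target space of
  \<open>continuous_pol\<close>.\<close>

lemma pol_in_S:
  assumes "u \<in> S" "H \<in> topspace Hstar"
  shows "pol u H \<in> S"
  using continuous_map_image_subset_topspace[OF continuous_pol] assms by (auto simp: subset_iff image_iff)

lemma iter_pol_in_S: "u \<in> S \<Longrightarrow> range Hs \<subseteq> topspace Hstar \<Longrightarrow> iter_pol pol Hs m u \<in> S"
  by (induction m) (auto intro!: pol_in_S)

lemma star_iter_pol: "u \<in> S \<Longrightarrow> range Hs \<subseteq> topspace Hstar \<Longrightarrow> star (iter_pol pol Hs m u) = star u"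
  by (induction m) (auto simp: star_pol iter_pol_in_S image_subset_iff)

lemma iter_pol_star: "u \<in> S \<Longrightarrow> range Hs \<subseteq> topspace Hstar \<Longrightarrow> iter_pol pol Hs m (star u) = star u"
  by (induction m) (auto simp: pol_star image_subset_iff)

lemma iter_pol_nonexpansive:
  assumes "u \<in> S" "v \<in> S" "range Hs \<subseteq> topspace Hstar"
  shows "norm (\<iota>V (iter_pol pol Hs m u - iter_pol pol Hs m v)) \<le> norm (\<iota>V (u - v))"
proof (induction m)
  case (Suc m)
  have "norm (\<iota>V (iter_pol pol Hs (Suc m) u - iter_pol pol Hs (Suc m) v)) \<le>
      norm (\<iota>V (iter_pol pol Hs m u - iter_pol pol Hs m v))"
    using assms by (auto intro!: pol_nonexpansive iter_pol_in_S)
  then show ?case using Suc by linarith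
qed simp

text \<open>Serves for both \<open>f\<close> and the norm of \<open>X\<close>.\<close>

lemma iter_pol_le:
  fixes g :: "'x \<Rightarrow> real"
  assumes "u \<in> S" "range Hs \<subseteq> topspace Hstar"
    and "\<And>u H. u \<in> S \<Longrightarrow> H \<in> topspace Hstar \<Longrightarrow> g (pol u H) \<le> g u"
  shows "g (iter_pol pol Hs m u) \<le> g u"
proof (induction m)
  case (Suc m)
  have "g (iter_pol pol Hs (Suc m) u) \<le> g (iter_pol pol Hs m u)"
    using assms by (auto intro!: assms(3) iter_pol_in_S)
  then show ?case using Suc by linarith
qed simp

text \<open>One sequence of polarizers symmetrizes both points, so nonexpansiveness of the iterates
  passes to the limit in \<open>V\<close>.\<close>

lemma star_nonexpansive:
  assumes "u \<in> S" "v \<in> S"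
  shows "norm (\<iota>V (star u - star v)) \<le> norm (\<iota>V (u - v))"
proof -
  interpret V: bounded_linear \<iota>V by (rule embed_V)
  obtain Hs where Hs: "range Hs \<subseteq> topspace Hstar"
    and lim: "\<And>u. u \<in> S \<Longrightarrow> (\<lambda>m. \<iota>V (iter_pol pol Hs m u)) \<longlonglongrightarrow> \<iota>V (star u)"
    using iter_pol_tendsto_star by blast
  have "(\<lambda>m. norm (\<iota>V (iter_pol pol Hs m u - iter_pol pol Hs m v))) \<longlonglongrightarrow> norm (\<iota>V (star u - star v))"
    unfolding V.diff by (intro tendsto_intros lim assms)
  then show ?thesis
    by (rule LIMSEQ_le_const2) (use iter_pol_nonexpansive[OF assms Hs] in auto)
qed

text \<open>Iterated polarizations leave \<open>star u\<close> unchanged, yet they converge in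
  \<open>V\<close> to \<open>star (star u)\<close>; injectivity of \<open>\<iota>V\<close>
  identifies the two.\<close>

lemma star_star:
  assumes "u \<in> S"
  shows "star (star u) = star u"
proof -
  obtain Hs where Hs: "range Hs \<subseteq> topspace Hstar"
    and lim: "\<And>u. u \<in> S \<Longrightarrow> (\<lambda>m. \<iota>V (iter_pol pol Hs m u)) \<longlonglongrightarrow> \<iota>V (star u)"
    using iter_pol_tendsto_star by blast
  have "(\<lambda>m. \<iota>V (star u)) \<longlonglongrightarrow> \<iota>V (star (star u))"
    using lim[OF star_in_S[OF assms]] iter_pol_star[OF assms Hs] by simp
  then show ?thesis using embed_V(2) by (auto dest!: LIMSEQ_unique[OF tendsto_const] injD)
qed

lemma star_Theta_Lipschitz:
  "\<exists>C>0. \<forall>u v. norm (\<iota>V (star (\<Theta> u) - star (\<Theta> v))) \<le> C * norm (\<iota>V (u - v))"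
  using Theta_Lipschitz star_nonexpansive[OF Theta_in_S Theta_in_S] by (meson order_trans)

end

section \<open>Construction of almost symmetric, almost critical points, and their limits\<close>

text \<open>The perturbed point \<open>v\<close> may leave \<open>S\<close>, so compactness in
  \<open>W\<close> has to be applied to a symmetric companion \<open>q\<close> close to it in
  \<open>V\<close>. The constants \<open>M\<close> and \<open>K\<close> are uniform in
  \<open>a\<close>, so that \<open>a\<close> can tend to \<open>0\<close>.\<close>

lemma nearly_symmetric_almost_minimizers:
  fixes \<iota>V :: "'x::{real_inner, banach} \<Rightarrow> 'v::banach"
    and \<iota>W :: "'v \<Rightarrow> 'w::banach"
    and f :: "'x \<Rightarrow> real"
  assumes frame: "symmetrization_framework \<iota>V \<iota>W S Hstar pol star \<Theta>"
    and star_le: "\<And>u. norm (star (\<Theta> u)) \<le> norm u"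
    and lsc: "lower_semicontinuous f" and bdd: "bdd_below (range f)"
    and f_pol: "\<And>u H. u \<in> S \<Longrightarrow> H \<in> topspace Hstar \<Longrightarrow> f (pol u H) \<le> f u"
    and norm_pol: "\<And>u H. u \<in> S \<Longrightarrow> H \<in> topspace Hstar \<Longrightarrow> norm (pol u H) \<le> norm u"
    and u: "range u \<subseteq> S" "bounded (range u)" "(\<lambda>n. f (u n)) \<longlonglongrightarrow> (INF x. f x)"
  shows "\<exists>M K. \<forall>a. 0 < a \<longrightarrow> a \<le> 1 \<longrightarrow> (\<exists>v p q. q \<in> symmetric_elements S star \<and>
           norm v \<le> M \<and> norm q \<le> M \<and> norm (\<iota>V (v - q)) \<le> K * a \<and>
           norm (\<iota>V (v - star (\<Theta> v))) \<le> K * a \<and> norm p \<le> 16 * a \<and> f v \<le> (INF x. f x) + a \<and>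
           (\<forall>w. f v \<le> f w + 2 * a * (norm (w - v))\<^sup>2 + p \<bullet> (w - v)))"
proof -
  interpret symmetrization_framework \<iota>V \<iota>W S Hstar pol star \<Theta> by (rule frame)
  interpret V: bounded_linear \<iota>V by (rule embed_V)
  obtain B where B: "B > 0" "\<And>x. norm (\<iota>V x) \<le> norm x * B" using V.pos_bounded by blast
  obtain C where C: "C > 0" "\<And>u v. norm (\<iota>V (star (\<Theta> u) - star (\<Theta> v))) \<le> C * norm (\<iota>V (u - v))"
    using star_Theta_Lipschitz by blast
  obtain R where R: "\<And>n. norm (u n) \<le> R" using u(2) unfolding bounded_iff by blast
  obtain Hs where Hs: "range Hs \<subseteq> topspace Hstar"
    and lim: "\<And>u. u \<in> S \<Longrightarrow> (\<lambda>m. \<iota>V (iter_pol pol Hs m u)) \<longlonglongrightarrow> \<iota>V (star u)"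
    using iter_pol_tendsto_star by blast
  \<comment> \<open>\<open>2 * B\<close> pays for the passage from \<open>v\<close> to the polarized
    point \<open>y\<close>, \<open>1\<close> for that from \<open>y\<close> to
    \<open>star \<xi>\<close>, and \<open>C * (2 * B)\<close> for that from \<open>star y\<close> to
    \<open>star (\<Theta> v)\<close>.\<close>
  define K where "K = 2 * B + 1 + C * (2 * B)"
  have "\<exists>v p q. q \<in> symmetric_elements S star \<and>
           norm v \<le> R + 2 \<and> norm q \<le> R + 2 \<and> norm (\<iota>V (v - q)) \<le> K * a \<and>
           norm (\<iota>V (v - star (\<Theta> v))) \<le> K * a \<and> norm p \<le> 16 * a \<and> f v \<le> (INF x. f x) + a \<and>
           (\<forall>w. f v \<le> f w + 2 * a * (norm (w - v))\<^sup>2 + p \<bullet> (w - v))" if a: "0 < a" "a \<le> 1" for a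
  proof -
    \<comment> \<open>The accuracy \<open>a * a\<^sup>2\<close> is what the Borwein--Preiss lemma
      requires for \<open>\<eta> = \<rho> = a\<close>.\<close>
    have "a * a\<^sup>2 > 0" using a by simp
    then have "\<forall>\<^sub>F n in sequentially. f (u n) < (INF x. f x) + a * a\<^sup>2"
      by (intro order_tendstoD[OF u(3)]) simp
    then obtain n where n: "f (u n) < (INF x. f x) + a * a\<^sup>2" unfolding eventually_sequentially by blast
    define \<xi> where "\<xi> = u n"
    have \<xi>: "\<xi> \<in> S" "norm \<xi> \<le> R" using u(1) R by (auto simp: \<xi>_def)
    \<comment> \<open>The number of polarizations depends on \<open>\<xi>\<close>. The
      symmetrization is unchanged by them, so the iterate is close to its own
      symmetrization.\<close>
    obtain m where m: "dist (\<iota>V (iter_pol pol Hs m \<xi>)) (\<iota>V (star \<xi>)) < a"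
      using tendstoD[OF lim[OF \<xi>(1)] a(1)] unfolding eventually_sequentially by blast
    define y where "y = iter_pol pol Hs m \<xi>"
    have y: "y \<in> S" "star y = star \<xi>" "f y \<le> f \<xi>" "norm y \<le> norm \<xi>"
      unfolding y_def using \<xi> Hs
      by (auto intro!: iter_pol_in_S star_iter_pol iter_pol_le[of _ _ f] iter_pol_le[of _ _ norm] f_pol norm_pol)
    have "f y \<le> f w + a * a\<^sup>2" for w
      using cINF_lower[OF bdd, of w] y(3) n by (simp add: \<xi>_def)
    from Borwein_Preiss_Hilbert[OF lsc bdd a(1) a(1) this]
    obtain v p where v: "norm (v - y) \<le> 2 * a" "norm p \<le> 16 * a * a" "f v \<le> f y"
      "\<And>w. f v \<le> f w + 2 * a * (norm (w - v))\<^sup>2 + p \<bullet> (w - v)" by blast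
    have a2: "a * a \<le> a" using a by (simp add: mult_left_le)
    have a3: "a * a\<^sup>2 \<le> a" using a by (simp add: mult_left_le power_le_one)
    have vy: "norm (\<iota>V (v - y)) \<le> 2 * B * a"
      using order_trans[OF B(2) mult_right_mono[OF v(1), of B]] B(1) by (simp add: mult_ac)
    have yq: "norm (\<iota>V (y - star \<xi>)) \<le> a"
      using m by (simp add: y_def dist_norm V.diff)
    have "norm (\<iota>V (v - star \<xi>)) \<le> norm (\<iota>V (v - y)) + norm (\<iota>V (y - star \<xi>))"
      using norm_triangle_ineq[of "\<iota>V (v - y)" "\<iota>V (y - star \<xi>)"] by (simp flip: V.add)
    then have vq: "norm (\<iota>V (v - star \<xi>)) \<le> (2 * B + 1) * a" using vy yq by (simp add: algebra_simps)
    have "norm (\<iota>V (star (\<Theta> y) - star (\<Theta> v))) \<le> C * norm (\<iota>V (v - y))"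
      using C(2)[of v y] by (simp add: V.diff norm_minus_commute)
    also have "\<dots> \<le> C * (2 * B) * a" using mult_left_mono[OF vy, of C] C(1) by (simp add: mult_ac)
    finally have qv: "norm (\<iota>V (star \<xi> - star (\<Theta> v))) \<le> C * (2 * B) * a"
      using Theta_id[OF y(1)] y(2) by simp
    have "norm (\<iota>V (v - star (\<Theta> v))) \<le> norm (\<iota>V (v - star \<xi>)) + norm (\<iota>V (star \<xi> - star (\<Theta> v)))"
      using norm_triangle_ineq[of "\<iota>V (v - star \<xi>)" "\<iota>V (star \<xi> - star (\<Theta> v))"] by (simp flip: V.add)
    then have vv: "norm (\<iota>V (v - star (\<Theta> v))) \<le> K * a" using vq qv by (simp add: K_def algebra_simps)
    have vq': "norm (\<iota>V (v - star \<xi>)) \<le> K * a"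
      by (rule order_trans[OF vq], rule mult_right_mono) (use B(1) C(1) a in \<open>auto simp: K_def\<close>)
    have "norm v \<le> R + 2"
      using norm_triangle_ineq[of y "v - y"] v(1) y(4) \<xi>(2) a by simp
    moreover have "norm (star \<xi>) \<le> R + 2"
      using star_le[of \<xi>] Theta_id[OF \<xi>(1)] \<xi>(2) by simp
    moreover have "star \<xi> \<in> symmetric_elements S star"
      using \<xi>(1) by (simp add: symmetric_elements_def star_in_S star_star)
    moreover have "f v \<le> (INF x. f x) + a" using v(3) y(3) n a3 by (simp add: \<xi>_def)
    moreover have "norm p \<le> 16 * a" using v(2) a2 by simp
    ultimately show ?thesis using v(4) vv vq' by blast
  qed
  then show ?thesis by blast
qed

text \<open>Every clause is squeezed by a multiple of \<open>a n\<close>; the support inequality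
  \<open>min\<close> controls the weak slope through \<open>norm (p n)\<close> and the second
  quotient through \<open>c * a n\<close>.\<close>

lemma SQPS_sequence_of_almost_minimizers:
  fixes f :: "'x::{real_inner, banach} \<Rightarrow> real"
  assumes bdd: "bdd_below (range f)"
    and a: "a \<longlonglongrightarrow> 0" "\<And>n. a n \<ge> 0"
    and f_le: "\<And>n. f (u n) \<le> (INF x. f x) + a n"
    and sym: "\<And>n. norm (\<iota>V (u n - star (\<Theta> (u n)))) \<le> K * a n"
    and p: "\<And>n. norm (p n) \<le> L * a n"
    and min: "\<And>n w. f (u n) \<le> f w + c * a n * (norm (w - u n))\<^sup>2 + p n \<bullet> (w - u n)" and c: "c \<ge> 0"
  shows "SQPS_sequence \<iota>V star \<Theta> f (INF x. f x) u"
  unfolding SQPS_sequence_def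
proof (intro conjI allI)
  have to_0: "(\<lambda>n. d * a n) \<longlonglongrightarrow> 0" for d
    using tendsto_mult[OF tendsto_const a(1), of d] by simp
  show "(\<lambda>n. f (u n)) \<longlonglongrightarrow> (INF x. f x)"
  proof (rule tendsto_sandwich[OF _ _ tendsto_const])
    show "(\<lambda>n. (INF x. f x) + a n) \<longlonglongrightarrow> (INF x. f x)"
      using tendsto_add[OF tendsto_const a(1)] by fastforce
  qed (use f_le cINF_lower[OF bdd] in auto)
  show "(\<lambda>n. weak_slope f (u n)) \<longlonglongrightarrow> 0"
  proof (rule tendsto_sandwich[OF _ _ tendsto_const])
    show "(\<lambda>n. ereal (L * a n)) \<longlonglongrightarrow> 0" using to_0[of L] by (simp add: zero_ereal_def)
    have "weak_slope f (u n) \<le> ereal (L * a n)" for n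
      using weak_slope_le_quadratic[OF min, of n] c a(2) p[of n]
      by (meson ereal_less_eq(3) mult_nonneg_nonneg order_trans)
    then show "\<forall>\<^sub>F n in sequentially. weak_slope f (u n) \<le> ereal (L * a n)" by simp
    show "\<forall>\<^sub>F n in sequentially. 0 \<le> weak_slope f (u n)" by (simp add: weak_slope_nonneg)
  qed
  show "(\<lambda>n. norm (\<iota>V (u n - star (\<Theta> (u n))))) \<longlonglongrightarrow> 0"
    by (rule tendsto_sandwich[OF _ _ tendsto_const to_0[of K]]) (use sym in auto)
  fix w :: 'x
  have "(\<lambda>n. - 2 * (c * a n) * (norm w)\<^sup>2) \<longlonglongrightarrow> - 2 * 0 * (norm w)\<^sup>2"
    by (intro tendsto_intros to_0)
  then have "(\<lambda>n. ereal (- 2 * (c * a n) * (norm w)\<^sup>2)) \<longlonglongrightarrow> 0" by (simp add: zero_ereal_def)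
  then have "0 = liminf (\<lambda>n. ereal (- 2 * (c * a n) * (norm w)\<^sup>2))"
    by (intro lim_imp_Liminf[symmetric]) auto
  also have "\<dots> \<le> liminf (\<lambda>n. second_quotient f (u n) w)"
    by (intro Liminf_mono always_eventually allI second_quotient_ge_quadratic[OF min])
  finally show "0 \<le> liminf (\<lambda>n. second_quotient f (u n) w)" .
qed

text \<open>The map sending \<open>u\<close> to \<open>star (\<Theta> u)\<close> is Lipschitz in
  \<open>V\<close>, so the symmetry defect vanishes at the limit. Then
  \<open>z = star (\<Theta> z)\<close> lies in \<open>S\<close>, and idempotence of
  \<open>star\<close> concludes.\<close>

lemma (in symmetrization_framework) limit_of_nearly_symmetric:
  assumes u: "u \<longlonglongrightarrow> z" and sym: "(\<lambda>n. norm (\<iota>V (u n - star (\<Theta> (u n))))) \<longlonglongrightarrow> 0"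
  shows "z \<in> S" "star z = z"
proof -
  interpret V: bounded_linear \<iota>V by (rule embed_V)
  obtain C where C: "\<And>u v. norm (\<iota>V (star (\<Theta> u) - star (\<Theta> v))) \<le> C * norm (\<iota>V (u - v))"
    using star_Theta_Lipschitz by blast
  have uz: "(\<lambda>n. \<iota>V (u n - z)) \<longlonglongrightarrow> \<iota>V 0"
    using V.tendsto[OF tendsto_diff[OF u tendsto_const[of z]]] by simp
  have "norm (\<iota>V (z - star (\<Theta> z))) \<le>
      norm (\<iota>V (u n - z)) + norm (\<iota>V (u n - star (\<Theta> (u n)))) + C * norm (\<iota>V (u n - z))" for n
  proof -
    have "\<iota>V (z - star (\<Theta> z)) = \<iota>V (u n - star (\<Theta> (u n))) + \<iota>V (star (\<Theta> (u n)) - star (\<Theta> z)) - \<iota>V (u n - z)"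
      by (simp add: V.diff)
    then have "norm (\<iota>V (z - star (\<Theta> z))) =
        norm (\<iota>V (u n - star (\<Theta> (u n))) + \<iota>V (star (\<Theta> (u n)) - star (\<Theta> z)) - \<iota>V (u n - z))"
      by (rule arg_cong)
    then show ?thesis
      using norm_triangle_ineq4[of "\<iota>V (u n - star (\<Theta> (u n))) + \<iota>V (star (\<Theta> (u n)) - star (\<Theta> z))" "\<iota>V (u n - z)"]
        norm_triangle_ineq[of "\<iota>V (u n - star (\<Theta> (u n)))" "\<iota>V (star (\<Theta> (u n)) - star (\<Theta> z))"] C[of "u n" z]
      by linarith
  qed
  moreover have "(\<lambda>n. norm (\<iota>V (u n - z)) + norm (\<iota>V (u n - star (\<Theta> (u n)))) + C * norm (\<iota>V (u n - z))) \<longlonglongrightarrow> norm (\<iota>V 0) + 0 + C * norm (\<iota>V 0)"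
    by (intro tendsto_intros uz sym)
  ultimately have "norm (\<iota>V (z - star (\<Theta> z))) \<le> 0"
    using LIMSEQ_le_const[of _ _ "norm (\<iota>V (z - star (\<Theta> z)))"] V.zero by fastforce
  then have "z = star (\<Theta> z)" using embed_V(2) by (simp add: V.diff inj_eq)
  then show "z \<in> S" "star z = z"
    using star_in_S[OF Theta_in_S[of z]] star_star[OF Theta_in_S[of z]] by simp_all
qed

section \<open>Existence of the sequence and of the symmetric minimizer\<close>

theorem corollary2p30:
  fixes \<iota>V :: "'x::{real_inner, banach} \<Rightarrow> 'v::banach"
    and \<iota>W :: "'v \<Rightarrow> 'w::banach"
    and S :: "'x set"
    and Hstar :: "'h topology"
    and pol :: "'x \<Rightarrow> 'h \<Rightarrow> 'x"
    and star \<Theta> \<Xi> :: "'x \<Rightarrow> 'x"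
    and f :: "'x \<Rightarrow> real"
  assumes "symmetrization_framework \<iota>V \<iota>W S Hstar pol star \<Theta>"
    and "symmetrically_embedded \<iota>V \<iota>W S star \<Theta>"
    and "lower_semicontinuous f"
    and "bdd_below (range f)"
    and "\<forall>u\<in>S. \<forall>H\<in>topspace Hstar. f (pol u H) \<le> f u"
    and "\<forall>u. \<Xi> u \<in> S \<and> f (\<Xi> u) \<le> f u"
    and "\<forall>u :: nat \<Rightarrow> 'x. bounded (range u) \<longrightarrow> bounded (range (\<lambda>n. \<Xi> (u n)))"
    and "\<forall>u\<in>S. \<forall>H\<in>topspace Hstar. norm (pol u H) \<le> norm u"
    and "\<exists>u :: nat \<Rightarrow> 'x. bounded (range u) \<and> (\<lambda>n. f (u n)) \<longlonglongrightarrow> (INF x. f x)"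
  shows "(\<exists>u x. SQPS_sequence \<iota>V star \<Theta> f (INF x. f x) u \<and>
            weakly_converges u x \<and>
            (\<lambda>n. \<iota>W (\<iota>V (u n))) \<longlonglongrightarrow> \<iota>W (\<iota>V x)) \<and>
         (SQPS_condition \<iota>V \<iota>W star \<Theta> f (INF x. f x) \<longrightarrow>
            (\<exists>z\<in>S. f z = (INF x. f x) \<and> weak_slope f z = 0 \<and> z = star z \<and>
               (\<forall>w. 0 \<le> second_quotient f z w)))"
proof -
  interpret symmetrization_framework \<iota>V \<iota>W S Hstar pol star \<Theta> by (rule assms(1))
  interpret V: bounded_linear \<iota>V by (rule embed_V)
  interpret W: bounded_linear \<iota>W by (rule embed_W)
  have star_le: "norm (star (\<Theta> u)) \<le> norm u" for u
    using assms(2) unfolding symmetrically_embedded_def by blast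
  have f_ge: "(INF x. f x) \<le> f w" for w using cINF_lower[OF assms(4)] by simp
  obtain y where y: "bounded (range y)" "(\<lambda>n. f (y n)) \<longlonglongrightarrow> (INF x. f x)" using assms(9) by blast
  \<comment> \<open>The values lie between the infimum and \<open>f (y n)\<close>, so the minimizing
    sequence may be taken in \<open>S\<close>.\<close>
  have "(\<lambda>n. f (\<Xi> (y n))) \<longlonglongrightarrow> (INF x. f x)"
    by (rule tendsto_sandwich[OF _ _ tendsto_const y(2)]) (use assms(6) f_ge in auto)
  then obtain M K where MK: "\<And>a. 0 < a \<Longrightarrow> a \<le> 1 \<Longrightarrow> \<exists>v p q. q \<in> symmetric_elements S star \<and>
           norm v \<le> M \<and> norm q \<le> M \<and> norm (\<iota>V (v - q)) \<le> K * a \<and>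
           norm (\<iota>V (v - star (\<Theta> v))) \<le> K * a \<and> norm p \<le> 16 * a \<and> f v \<le> (INF x. f x) + a \<and>
           (\<forall>w. f v \<le> f w + 2 * a * (norm (w - v))\<^sup>2 + p \<bullet> (w - v))"
    using nearly_symmetric_almost_minimizers[OF assms(1) star_le assms(3,4), of "\<lambda>n. \<Xi> (y n)"]
      assms(5,6,7,8) y(1) by (auto simp: image_subset_iff)
  define a where "a n = inverse (real (Suc n))" for n
  have a: "a \<longlonglongrightarrow> 0" "\<And>n. 0 < a n" "\<And>n. a n \<le> 1"
    using LIMSEQ_inverse_real_of_nat by (auto simp: a_def[abs_def] inverse_le_1_iff)
  have "\<exists>v p q. q \<in> symmetric_elements S star \<and>
           norm v \<le> M \<and> norm q \<le> M \<and> norm (\<iota>V (v - q)) \<le> K * a n \<and>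
           norm (\<iota>V (v - star (\<Theta> v))) \<le> K * a n \<and> norm p \<le> 16 * a n \<and> f v \<le> (INF x. f x) + a n \<and>
           (\<forall>w. f v \<le> f w + 2 * a n * (norm (w - v))\<^sup>2 + p \<bullet> (w - v))" for n
    using MK a by blast
  then obtain v p q where q: "\<And>n. q n \<in> symmetric_elements S star" "\<And>n. norm (q n) \<le> M"
    and v: "\<And>n. norm (v n) \<le> M" "\<And>n. norm (\<iota>V (v n - q n)) \<le> K * a n"
      "\<And>n. norm (\<iota>V (v n - star (\<Theta> (v n)))) \<le> K * a n" "\<And>n. f (v n) \<le> (INF x. f x) + a n"
    and p: "\<And>n. norm (p n) \<le> 16 * a n"
      "\<And>n w. f (v n) \<le> f w + 2 * a n * (norm (w - v n))\<^sup>2 + p n \<bullet> (w - v n)"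
    by metis
  have "range q \<subseteq> symmetric_elements S star" "bounded (range q)"
    using q by (auto simp: bounded_iff)
  then obtain r l where r: "strict_mono r" and l: "(\<lambda>n. \<iota>W (\<iota>V (q (r n)))) \<longlonglongrightarrow> l"
    using assms(2) unfolding symmetrically_embedded_def by blast
  define u where "u n = v (r n)" for n
  have ar: "(\<lambda>n. a (r n)) \<longlonglongrightarrow> 0" using LIMSEQ_subseq_LIMSEQ[OF a(1) r] by (simp add: comp_def)
  have SQPS: "SQPS_sequence \<iota>V star \<Theta> f (INF x. f x) u"
    unfolding u_def
    by (rule SQPS_sequence_of_almost_minimizers[where a = "\<lambda>n. a (r n)" and c = 2, OF assms(4) ar])
      (use v p a(2) in \<open>auto intro: less_imp_le\<close>)
  \<comment> \<open>The distance in \<open>V\<close> between \<open>u n\<close> and its companion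
    tends to \<open>0\<close>, so \<open>u\<close> inherits the limit of the companions in
    \<open>W\<close>.\<close>
  have "(\<lambda>n. K * a (r n)) \<longlonglongrightarrow> 0" using tendsto_mult[OF tendsto_const ar, of K] by simp
  then have "(\<lambda>n. \<iota>V (u n - q (r n))) \<longlonglongrightarrow> 0"
    by (rule Lim_null_comparison[rotated]) (use v(2) in \<open>auto simp: u_def\<close>)
  then have "(\<lambda>n. \<iota>W (\<iota>V (u n - q (r n))) + \<iota>W (\<iota>V (q (r n)))) \<longlonglongrightarrow> \<iota>W 0 + l"
    by (intro tendsto_add W.tendsto l)
  then have ul: "(\<lambda>n. \<iota>W (\<iota>V (u n))) \<longlonglongrightarrow> l" by (simp add: V.diff W.diff W.zero)
  have "bounded (range u)" using v(1) by (auto simp: bounded_iff u_def)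
  moreover have "bounded_linear (\<lambda>x. \<iota>W (\<iota>V x))"
    using bounded_linear_compose[OF embed_W(1) embed_V(1)] by simp
  moreover have "inj (\<lambda>x. \<iota>W (\<iota>V x))"
    using inj_compose[OF embed_W(2) embed_V(2)] by (simp add: comp_def)
  ultimately obtain x where x: "weakly_converges u x" "\<iota>W (\<iota>V x) = l"
    using weakly_converges_of_injective_image ul by blast
  have "\<exists>z\<in>S. f z = (INF x. f x) \<and> weak_slope f z = 0 \<and> z = star z \<and> (\<forall>w. 0 \<le> second_quotient f z w)"
    if cond: "SQPS_condition \<iota>V \<iota>W star \<Theta> f (INF x. f x)"
  proof -
    have "\<exists>r l. strict_mono r \<and> (\<lambda>n. \<iota>W (\<iota>V (u (r n)))) \<longlonglongrightarrow> l"
      using ul by (intro exI[of _ id] exI[of _ l]) (simp add: strict_mono_id)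
    then obtain s z where s: "strict_mono s" and z: "(\<lambda>n. u (s n)) \<longlonglongrightarrow> z"
      using cond[unfolded SQPS_condition_def, rule_format, OF SQPS] by blast
    have "(\<lambda>n. norm (\<iota>V (u n - star (\<Theta> (u n))))) \<longlonglongrightarrow> 0" and fu: "(\<lambda>n. f (u n)) \<longlonglongrightarrow> (INF x. f x)"
      using SQPS unfolding SQPS_sequence_def by blast+
    then have zS: "z \<in> S" "star z = z"
      using limit_of_nearly_symmetric[OF z] LIMSEQ_subseq_LIMSEQ[OF _ s] by (auto simp: comp_def)
    have "f z \<le> (INF x. f x)"
      using LIMSEQ_subseq_LIMSEQ[OF fu s] z assms(3)
      by (intro lower_semicontinuous_limit_le[of f "\<lambda>n. u (s n)" z "\<lambda>n. f (u (s n))"]) (auto simp: comp_def)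
    then have fz: "f z = (INF x. f x)" using f_ge[of z] by simp
    \<comment> \<open>A global minimizer has the trivial support with \<open>s = 0\<close> and
      \<open>p = 0\<close>, so the two quadratic estimates give slope at most \<open>0\<close> and
      second quotient at least \<open>0\<close>.\<close>
    then have min: "f z \<le> f w + 0 * (norm (w - z))\<^sup>2 + 0 \<bullet> (w - z)" for w using f_ge[of w] by simp
    have "weak_slope f z = 0"
      using weak_slope_le_quadratic[OF min] weak_slope_nonneg[of f z] by (simp add: zero_ereal_def[symmetric])
    moreover have "0 \<le> second_quotient f z w" for w
      using second_quotient_ge_quadratic[OF min, of w] by (simp add: zero_ereal_def[symmetric])
    ultimately show ?thesis using zS fz by auto
  qed
  then show ?thesis using SQPS x ul by blast
qed

end
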